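(* Let $\mathcal{T}$ be a finite collection of prototiles in $\mathbb{R}^d$ and let $x\in X_{\mathcal{T}}$ be a tiling. If $x$ is repetitive, then its hull $\overline{\operatorname{orb}(x)}$ is minimal. If $x$ has finite local complexity, then minimality of $\overline{\operatorname{orb}(x)}$ implies that $x$ is repetitive.
   Context: Fix $d\ge 1$ and a norm $\|\cdot\|$ on $\mathbb{R}^d$. For $r>0$, $B_r$ is the closed ball of radius $r$ centered at the origin; $B(t,r)$ is the open ball of center $t$ and radius $r$. A tile is a nonempty compact connected subset of $\mathbb{R}^d$ that equals the closure of its interior. A tiling is a collection of tiles with pairwise disjoint interiors whose union is $\mathbb{R}^d$. Two tiles are equivalent if one is a translate of the other; the equivalence classes are called prototiles. For a finite collection $\mathcal{T}$ of prototiles, the full tiling space $X_{\mathcal{T}}$ is the set of all tilings of $\mathbb{R}^d$ each of whose tiles belongs to some prototile in $\mathcal{T}$. A patch is a nonempty finite subset $y$ of some tiling in $X_{\mathcal{T}}$ such that the union of the tiles in $y$, called its support $\operatorname{supp}(y)$, is connected. For a set $x$ of tiles and $v\in\mathbb{R}^d$, $T_v x:=\{D-v : D\in x\}$; this defines an action $T$ of $\mathbb{R}^d$ on $X_{\mathcal{T}}$. Two patches are equivalent if one is a translate of the other. A tiling $x\in X_{\mathcal{T}}$ has finite local complexity if, up to translation, only finitely many patches consisting of two tiles are contained in $x$. For $x\in X_{\mathcal{T}}$ and compact connected $K\subset\mathbb{R}^d$, $x[[K]]$ denotes the set of patches $x'\subset x$ with $K\subset\operatorname{supp}(x')$. $X_{\mathcal{T}}$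 is endowed with the metric $d_1(x,y)=\min\left(\frac{1}{\sqrt2},\tilde d_1(x,y)\right)$, where $$\tilde d_1(x,y)=\inf\left\{0<r<\tfrac{1}{\sqrt2} : \exists x'\in x[[B_{1/r}]],\ \exists y'\in y[[B_{1/r}]],\ \exists v\in B_r,\ T_v x'=y'\right\}$$ (with $\inf\emptyset=+\infty$). $\operatorname{orb}(x):=\{T_v x: v\in\mathbb{R}^d\}$, and $\overline{\operatorname{orb}(x)}$ is its closure in $(X_{\mathcal{T}},d_1)$. A closed $\mathbb{R}^d$-invariant set $Y\subset X_{\mathcal{T}}$ is minimal if $\overline{\operatorname{orb}(y)}=Y$ for every $y\in Y$. A tiling $x\in X_{\mathcal{T}}$ is repetitive if for every patch $x'\subset x$ there is $r>0$ such that for every $t\in\mathbb{R}^d$ there is $s\in\mathbb{R}^d$ with $T_s x'\subset x$ and $\operatorname{supp}(T_s x')\subset B(t,r)$. *)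

theory Defs
  imports "HOL-Analysis.Analysis"
begin

text \<open>
  The norm on $\mathbb{R}^d$ is arbitrary, so it is a parameter \<open>N\<close> rather than the Euclidean
  \<open>norm\<close> of the type class. Compactness, connectedness, closure and interior do not depend on the
  choice of norm and refer to the standard topology of \<open>real ^ 'd\<close>.
\<close>

definition is_norm :: "(real ^ 'd \<Rightarrow> real) \<Rightarrow> bool" where
  "is_norm N \<longleftrightarrow>
     (\<forall>p. 0 \<le> N p) \<and> (\<forall>p. N p = 0 \<longleftrightarrow> p = 0) \<and>
     (\<forall>c p. N (c *\<^sub>R p) = \<bar>c\<bar> * N p) \<and> (\<forall>p q. N (p + q) \<le> N p + N q)"

definition nball :: "(real ^ 'd \<Rightarrow> real) \<Rightarrow> real ^ 'd \<Rightarrow> real \<Rightarrow> (real ^ 'd) set" where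
  "nball N t r = {p. N (p - t) < r}"

definition ncball0 :: "(real ^ 'd \<Rightarrow> real) \<Rightarrow> real \<Rightarrow> (real ^ 'd) set" where
  "ncball0 N r = {p. N p \<le> r}"

definition tile :: "(real ^ 'd) set \<Rightarrow> bool" where
  "tile D \<longleftrightarrow> D \<noteq> {} \<and> compact D \<and> connected D \<and> D = closure (interior D)"

definition tiling :: "(real ^ 'd) set set \<Rightarrow> bool" where
  "tiling x \<longleftrightarrow>
     (\<forall>D\<in>x. tile D) \<and>
     pairwise (\<lambda>D E. interior D \<inter> interior E = {}) x \<and>
     \<Union>x = UNIV"

definition shift_tile :: "real ^ 'd \<Rightarrow> (real ^ 'd) set \<Rightarrow> (real ^ 'd) set" where
  "shift_tile v D = (\<lambda>p. p - v) ` D"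

definition shift :: "real ^ 'd \<Rightarrow> (real ^ 'd) set set \<Rightarrow> (real ^ 'd) set set" where
  "shift v x = shift_tile v ` x"

definition tile_rel :: "((real ^ 'd) set \<times> (real ^ 'd) set) set" where
  "tile_rel = {(D, E). tile D \<and> tile E \<and> (\<exists>v. E = shift_tile v D)}"

definition prototiles :: "(real ^ 'd) set set set" where
  "prototiles = {D. tile D} // tile_rel"

definition tiling_space :: "(real ^ 'd) set set set \<Rightarrow> (real ^ 'd) set set set" where
  "tiling_space \<T> = {x. tiling x \<and> (\<forall>D\<in>x. \<exists>P\<in>\<T>. D \<in> P)}"

definition patch :: "(real ^ 'd) set set set \<Rightarrow> (real ^ 'd) set set \<Rightarrow> bool" where
  "patch \<T> y \<longleftrightarrow> y \<noteq> {} \<and> finite y \<and> (\<exists>x\<in>tiling_space \<T>. y \<subseteq> x) \<and> connected (\<Union>y)"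

definition patch_rel ::
    "(real ^ 'd) set set set \<Rightarrow> ((real ^ 'd) set set \<times> (real ^ 'd) set set) set" where
  "patch_rel \<T> = {(y, z). patch \<T> y \<and> patch \<T> z \<and> (\<exists>v. z = shift v y)}"

definition finite_local_complexity ::
    "(real ^ 'd) set set set \<Rightarrow> (real ^ 'd) set set \<Rightarrow> bool" where
  "finite_local_complexity \<T> x \<longleftrightarrow>
     finite ({y. patch \<T> y \<and> y \<subseteq> x \<and> card y = 2} // patch_rel \<T>)"

definition patches_covering ::
    "(real ^ 'd) set set set \<Rightarrow> (real ^ 'd) set set \<Rightarrow> (real ^ 'd) set \<Rightarrow> (real ^ 'd) set set set" where
  "patches_covering \<T> x K = {x'. patch \<T> x' \<and> x' \<subseteq> x \<and> K \<subseteq> \<Union>x'}"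

definition repetitive ::
    "(real ^ 'd \<Rightarrow> real) \<Rightarrow> (real ^ 'd) set set set \<Rightarrow> (real ^ 'd) set set \<Rightarrow> bool" where
  "repetitive N \<T> x \<longleftrightarrow>
     (\<forall>x'. patch \<T> x' \<and> x' \<subseteq> x \<longrightarrow>
        (\<exists>r>0. \<forall>t. \<exists>s. shift s x' \<subseteq> x \<and> \<Union>(shift s x') \<subseteq> nball N t r))"

text \<open>
  The infimum is taken in \<open>ereal\<close>, so that the infimum of the empty set is \<open>\<infinity>\<close>.
\<close>

definition tiling_dist_pre ::
    "(real ^ 'd \<Rightarrow> real) \<Rightarrow> (real ^ 'd) set set set \<Rightarrow> (real ^ 'd) set set \<Rightarrow> (real ^ 'd) set set \<Rightarrow> ereal" where
  "tiling_dist_pre N \<T> x y =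
     Inf (ereal ` {r. 0 < r \<and> r < 1 / sqrt 2 \<and>
       (\<exists>x'\<in>patches_covering \<T> x (ncball0 N (1 / r)).
        \<exists>y'\<in>patches_covering \<T> y (ncball0 N (1 / r)).
        \<exists>v\<in>ncball0 N r. shift v x' = y')})"

definition tiling_dist ::
    "(real ^ 'd \<Rightarrow> real) \<Rightarrow> (real ^ 'd) set set set \<Rightarrow> (real ^ 'd) set set \<Rightarrow> (real ^ 'd) set set \<Rightarrow> real" where
  "tiling_dist N \<T> x y = real_of_ereal (min (ereal (1 / sqrt 2)) (tiling_dist_pre N \<T> x y))"

definition tiling_topology ::
    "(real ^ 'd \<Rightarrow> real) \<Rightarrow> (real ^ 'd) set set set \<Rightarrow> (real ^ 'd) set set topology" where
  "tiling_topology N \<T> = Metric_space.mtopology (tiling_space \<T>) (tiling_dist N \<T>)"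

definition orb :: "(real ^ 'd) set set \<Rightarrow> (real ^ 'd) set set set" where
  "orb x = range (\<lambda>v. shift v x)"

definition orbit_closure ::
    "(real ^ 'd \<Rightarrow> real) \<Rightarrow> (real ^ 'd) set set set \<Rightarrow> (real ^ 'd) set set \<Rightarrow> (real ^ 'd) set set set" where
  "orbit_closure N \<T> x = tiling_topology N \<T> closure_of orb x"

definition minimal_set ::
    "(real ^ 'd \<Rightarrow> real) \<Rightarrow> (real ^ 'd) set set set \<Rightarrow> (real ^ 'd) set set set \<Rightarrow> bool" where
  "minimal_set N \<T> Y \<longleftrightarrow>
     closedin (tiling_topology N \<T>) Y \<and>
     (\<forall>v. \<forall>y\<in>Y. shift v y \<in> Y) \<and>
     (\<forall>y\<in>Y. orbit_closure N \<T> y = Y)"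

end

theory Submission
  imports Defs
begin

text \<open>
  Say that \<open>x\<close> and \<open>y\<close> match at scale \<open>r\<close> if they agree on the ball of radius \<open>1 / r\<close> after a
  translation by at most \<open>r\<close>. Matching is governed by tiles meeting balls, because a patch
  contains every tile that meets an open set covered by the patch. The hull of \<open>x\<close> is minimal iff
  \<open>x\<close> lies in the hull of each of its elements \<open>y\<close>.

  If \<open>x\<close> is repetitive, some translate of \<open>x\<close> matches \<open>y\<close> on a ball so large that it contains a
  copy of any given patch of \<open>x\<close>; hence the orbit of \<open>y\<close> approximates \<open>x\<close>.

  Conversely, if a patch has no copy in balls \<open>B(t n, n)\<close>, take translates \<open>z n\<close> of \<open>x\<close> by nearly
  \<open>t n\<close>, moved so that each contains one of finitely many fixed tiles. By compactness of
  \<open>{0, 1}\<close>-valued functions the \<open>z n\<close>, viewed as sets of tiles, have a cluster point \<open>Z\<close>.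
  Finite local complexity makes the support of \<open>Z\<close> open, and local finiteness makes it closed, so
  \<open>Z\<close> is a tiling in the hull. It contains no copy of the patch, contradicting minimality.
\<close>

section \<open>Translations\<close>

lemma mem_shift_tile [simp]: "p \<in> shift_tile v D \<longleftrightarrow> p + v \<in> D"
  unfolding shift_tile_def by (auto simp: image_iff) (metis add_diff_cancel_right')

lemma shift_tile_0 [simp]: "shift_tile 0 D = D"
  by (auto simp: set_eq_iff)

lemma shift_tile_shift_tile [simp]: "shift_tile v (shift_tile w D) = shift_tile (v + w) D"
  by (auto simp: set_eq_iff add.assoc)

lemma shift_tile_eq_iff: "shift_tile v D = E \<longleftrightarrow> D = shift_tile (- v) E"
  by (metis add.left_inverse add.right_inverse shift_tile_0 shift_tile_shift_tile)

lemma inj_shift_tile: "inj (shift_tile v)"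
  by (rule injI) (metis shift_tile_eq_iff)

lemma shift_0 [simp]: "shift 0 x = x"
  by (simp add: shift_def)

lemma shift_shift [simp]: "shift v (shift w x) = shift (v + w) x"
  by (simp add: shift_def image_image)

lemma mem_shift: "D \<in> shift v x \<longleftrightarrow> shift_tile (- v) D \<in> x"
  unfolding shift_def by (auto simp: image_iff) (metis add.right_inverse shift_tile_0 shift_tile_shift_tile)

lemma shift_mono_iff: "shift v x \<subseteq> shift v y \<longleftrightarrow> x \<subseteq> y"
  by (simp add: shift_def inj_image_subset_iff inj_shift_tile)

lemma shift_subset_iff: "shift v x \<subseteq> y \<longleftrightarrow> x \<subseteq> shift (- v) y"
  by (metis add.left_inverse shift_0 shift_mono_iff shift_shift)

lemma Union_shift: "\<Union> (shift v x) = shift_tile v (\<Union> x)"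
  by (auto simp: shift_def)

lemma interior_shift_tile: "interior (shift_tile v D) = shift_tile v (interior D)"
  by (simp add: shift_tile_def interior_translation_subtract)

lemma connected_shift_tile [simp]: "connected (shift_tile v D) \<longleftrightarrow> connected D"
proof -
  have "connected (shift_tile v D)" if "connected D" for v and D :: "(real ^ 'd) set"
    unfolding shift_tile_def by (intro connected_continuous_image that continuous_intros)
  from this[of D v] this[of "shift_tile v D" "- v"] show ?thesis by auto
qed

lemma tile_shift_tile [simp]: "tile (shift_tile v D) \<longleftrightarrow> tile D"
proof -
  have "tile (shift_tile v D)" if "tile D" for v and D :: "(real ^ 'd) set"
  proof -
    have "closure (interior (shift_tile v D)) = shift_tile v (closure (interior D))"
      by (simp add: interior_shift_tile) (simp add: shift_tile_def closure_translation_subtract)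
    then show ?thesis
      using that unfolding tile_def
      by (simp add: shift_tile_def compact_translation_subtract)
        (metis connected_shift_tile shift_tile_def)
  qed
  from this[of D v] this[of "shift_tile v D" "- v"] show ?thesis by auto
qed

text \<open>If the vectors differed by a nonzero \<open>u\<close>, translation by \<open>u\<close>
  would preserve \<open>D\<close>, and a point of the compact set \<open>D\<close> maximising the
  inner product with \<open>u\<close> could be pushed further.\<close>

lemma shift_tile_vector_inj:
  assumes "compact D" "D \<noteq> {}" "shift_tile v D = shift_tile w D"
  shows "v = w"
proof (rule ccontr)
  assume "v \<noteq> w"
  define u where "u = v - w"
  have "u \<noteq> 0" using \<open>v \<noteq> w\<close> by (simp add: u_def)
  have "D = shift_tile u D"
    using arg_cong[OF assms(3), of "shift_tile (- w)"] by (simp add: u_def)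
  then have u: "p + u \<in> D" if "p \<in> D" for p
    using that by (metis mem_shift_tile)
  obtain p where "p \<in> D" and p: "\<And>q. q \<in> D \<Longrightarrow> q \<bullet> u \<le> p \<bullet> u"
    using continuous_attains_sup[OF assms(1,2) continuous_on_inner[OF continuous_on_id
        continuous_on_const[where c = u]]] by auto
  from p[OF u[OF \<open>p \<in> D\<close>]] have "u \<bullet> u \<le> 0" by (simp add: inner_add_left)
  with \<open>u \<noteq> 0\<close> show False by (metis inner_gt_zero_iff not_le)
qed


section \<open>Packings by finitely many prototiles\<close>

text \<open>Membership in the tiling space minus the covering condition. The cluster point
  \<open>Z\<close> is at first known only to be a packing, and local finiteness must already apply
  to it then.\<close>

definition packing :: "(real ^ 'd) set set set \<Rightarrow> (real ^ 'd) set set \<Rightarrow> bool" where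
  "packing \<T> x \<longleftrightarrow> (\<forall>D\<in>x. tile D) \<and> pairwise (\<lambda>D E. interior D \<inter> interior E = {}) x \<and>
     (\<forall>D\<in>x. \<exists>P\<in>\<T>. D \<in> P)"

lemma tiling_space_iff: "x \<in> tiling_space \<T> \<longleftrightarrow> packing \<T> x \<and> \<Union> x = UNIV"
  by (auto simp: tiling_space_def tiling_def packing_def)

lemma packing_eqI:
  "\<lbrakk>packing \<T> x; D \<in> x; E \<in> x; p \<in> interior D; p \<in> interior E\<rbrakk> \<Longrightarrow> D = E"
  unfolding packing_def pairwise_def by blast

lemma tile_interior_nonempty: "tile D \<Longrightarrow> interior D \<noteq> {}"
  unfolding tile_def by auto

text \<open>Since \<open>D\<close> is the closure of its interior, \<open>interior D\<close> meets
  \<open>U\<close> in a nonempty open set \<open>V\<close>, which \<open>y\<close> covers. Finitely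
  many closed sets without interior points in \<open>V\<close> cannot cover it, so some tile of
  \<open>y\<close> shares an interior point with \<open>D\<close> and equals it.\<close>

lemma packing_absorb:
  assumes "packing \<T> x" "finite y" "y \<subseteq> x" "open U" "U \<subseteq> \<Union> y" "D \<in> x" "D \<inter> U \<noteq> {}"
  shows "D \<in> y"
proof -
  define V where "V = interior D \<inter> U"
  have cl: "D = closure (interior D)" and "\<forall>E\<in>y. closed E"
    using assms unfolding packing_def tile_def by (auto intro: compact_imp_closed)
  have "open V" unfolding V_def by (intro open_Int open_interior assms(4))
  have "V \<noteq> {}"
    using assms(7) cl open_Int_closure_eq_empty[OF assms(4), of "interior D"]
    by (auto simp: V_def Int_commute)
  have "\<exists>E\<in>y. interior E \<inter> V \<noteq> {}"
  proof (rule ccontr)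
    assume "\<not> ?thesis"
    then have E: "interior (E \<inter> V) = {}" if "E \<in> y" for E
      using that \<open>open V\<close> by (simp add: interior_Int interior_open)
    \<comment> \<open>The finite case of Baire's theorem: off the closed set \<open>E\<close>, the
      open set lies in the smaller union, where the induction hypothesis leaves nothing, so it lies
      in \<open>E\<close> itself.\<close>
    have "interior (\<Union>E\<in>z. E) \<inter> V = {}" if "finite z" "z \<subseteq> y" for z
      using that
    proof induction
      case (insert E z)
      have "closed E" using insert \<open>\<forall>E\<in>y. closed E\<close> by auto
      show ?case
      proof (rule ccontr)
        assume nonempty: "interior (\<Union>E\<in>insert E z. E) \<inter> V \<noteq> {}"
        define W where "W = interior (E \<union> \<Union> z) \<inter> V - E"
        have "open W" using \<open>closed E\<close> \<open>open V\<close> by (auto simp: W_def)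
        moreover have "W \<subseteq> \<Union> z" using interior_subset by (fastforce simp: W_def)
        ultimately have "W \<subseteq> interior (\<Union> z)" by (simp add: interior_maximal)
        then have "W = {}" using insert by (auto simp: W_def)
        then have "interior (E \<union> \<Union> z) \<inter> V \<subseteq> E \<inter> V" by (auto simp: W_def)
        moreover have "open (interior (E \<union> \<Union> z) \<inter> V)" using \<open>open V\<close> by auto
        ultimately have "interior (E \<union> \<Union> z) \<inter> V \<subseteq> interior (E \<inter> V)"
          by (simp add: interior_maximal)
        with E insert nonempty show False by auto
      qed
    qed simp
    from this[OF assms(2)] have "interior (\<Union> y) \<inter> V = {}" by simp
    moreover have "V \<subseteq> interior (\<Union> y)"
      using assms(5) \<open>open V\<close> by (intro interior_maximal) (auto simp: V_def)
    ultimately show False using \<open>V \<noteq> {}\<close> by auto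
  qed
  then obtain E p where "E \<in> y" "p \<in> interior E" "p \<in> interior D" by (auto simp: V_def)
  then show ?thesis using packing_eqI[OF assms(1,6), of E p] assms(3) by auto
qed

lemma prototile_translates:
  assumes "P \<in> prototiles" "D \<in> P"
  shows "E \<in> P \<longleftrightarrow> (\<exists>v. E = shift_tile v D) \<and> tile D"
proof -
  obtain D0 where D0: "tile D0" "P = tile_rel `` {D0}"
    using assms(1) unfolding prototiles_def quotient_def by auto
  then obtain v where v: "D = shift_tile v D0" using assms(2) by (auto simp: tile_rel_def)
  have "shift_tile w D0 = shift_tile (w - v) D" for w by (simp add: v)
  then have "(\<exists>w. E = shift_tile w D0) \<longleftrightarrow> (\<exists>w. E = shift_tile w D)"
    by (metis v shift_tile_shift_tile)
  then show ?thesis using D0 v by (auto simp: tile_rel_def)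
qed

lemma packing_shift:
  assumes "packing \<T> x" "\<T> \<subseteq> prototiles"
  shows "packing \<T> (shift v x)"
proof -
  have "\<exists>P\<in>\<T>. shift_tile v D \<in> P" if D: "D \<in> x" for D
  proof -
    obtain P where P: "P \<in> \<T>" "D \<in> P" "tile D" using assms(1) D by (auto simp: packing_def)
    then have "shift_tile v D \<in> P"
      using prototile_translates[of P D "shift_tile v D"] assms(2) by auto
    with P show ?thesis by blast
  qed
  moreover have "pairwise (\<lambda>D E. interior D \<inter> interior E = {}) (shift v x)"
    unfolding pairwise_def
  proof (intro ballI impI)
    fix D E assume D: "D \<in> shift v x" "E \<in> shift v x" "D \<noteq> E"
    then obtain D' E' where D': "D' \<in> x" "E' \<in> x" "D = shift_tile v D'" "E = shift_tile v E'"
      by (auto simp: shift_def)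
    with D have "interior D' \<inter> interior E' = {}"
      using packing_eqI[OF assms(1)] by blast
    then show "interior D \<inter> interior E = {}" by (auto simp: D' interior_shift_tile)
  qed
  ultimately show ?thesis using assms(1) unfolding packing_def by (auto simp: shift_def)
qed

lemma tiling_space_shift:
  assumes "x \<in> tiling_space \<T>" "\<T> \<subseteq> prototiles"
  shows "shift v x \<in> tiling_space \<T>"
  using assms packing_shift[of \<T> x v]
  by (auto simp: tiling_space_iff Union_shift)

text \<open>Translates of a fixed representative \<open>D0\<close> are separated: vectors closer
  than the radius of a ball inside \<open>D0\<close> give overlapping interiors. The translates
  meeting \<open>K\<close> have bounded vectors, and a bounded separated set is finite.\<close>

lemma packing_locally_finite:
  assumes x: "packing \<T> x" and \<T>: "finite \<T>" "\<T> \<subseteq> prototiles" and K: "bounded K"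
  shows "finite {D\<in>x. D \<inter> K \<noteq> {}}"
proof -
  have "finite {D\<in>x. D \<in> P \<and> D \<inter> K \<noteq> {}}" if P: "P \<in> \<T>" for P
  proof (cases "\<exists>D0\<in>x. D0 \<in> P")
    case True
    then obtain D0 where D0: "D0 \<in> x" "D0 \<in> P" by auto
    have "tile D0" using D0 x by (auto simp: packing_def)
    define V where "V = {v. shift_tile v D0 \<in> x \<and> shift_tile v D0 \<inter> K \<noteq> {}}"
    obtain p e where pe: "0 < e" "ball p e \<subseteq> interior D0"
      using tile_interior_nonempty[OF \<open>tile D0\<close>]
      by (metis all_not_in_conv open_contains_ball open_interior)
    have sep: "v = w" if vw: "v \<in> V" "w \<in> V" "dist v w < e" for v w
    proof -
      have "p - v \<in> interior (shift_tile v D0)" "p - v \<in> interior (shift_tile w D0)"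
        using vw(3) pe by (auto simp: interior_shift_tile dist_norm subset_iff)
      then have "shift_tile v D0 = shift_tile w D0"
        using packing_eqI[OF x] vw by (auto simp: V_def)
      then show ?thesis using \<open>tile D0\<close> shift_tile_vector_inj by (auto simp: tile_def)
    qed
    have "V \<subseteq> (\<lambda>(a, b). a - b) ` (D0 \<times> K)"
    proof
      fix v assume "v \<in> V"
      then obtain q where "q \<in> K" "q + v \<in> D0" by (auto simp: V_def)
      then show "v \<in> (\<lambda>(a, b). a - b) ` (D0 \<times> K)" by (force simp: image_iff)
    qed
    moreover have "bounded D0" using \<open>tile D0\<close> by (simp add: tile_def compact_imp_bounded)
    ultimately have "bounded V"
      using bounded_minus[OF _ K, of D0] by (meson bounded_subset)
    have "finite V"
    proof (rule ccontr)
      assume "infinite V"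
      with \<open>bounded V\<close> obtain l where "l islimpt V" using bounded_infinite_imp_islimpt by blast
      then have inf: "infinite (V \<inter> ball l (e / 2))"
        using pe by (simp add: islimpt_eq_infinite_ball)
      then obtain v where v: "v \<in> V \<inter> ball l (e / 2)"
        by (metis all_not_in_conv finite.emptyI)
      from inf obtain w where w: "w \<in> V \<inter> ball l (e / 2)" "w \<noteq> v"
        by (metis finite.emptyI finite_insert finite_subset insertCI subsetI)
      have "dist v w < e"
        using v w dist_triangle_half_r[of l v e w] by auto
      then show False using sep v w by auto
    qed
    moreover have "{D\<in>x. D \<in> P \<and> D \<inter> K \<noteq> {}} \<subseteq> (\<lambda>v. shift_tile v D0) ` V"
    proof
      fix D assume D: "D \<in> {D\<in>x. D \<in> P \<and> D \<inter> K \<noteq> {}}"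
      then obtain v where "D = shift_tile v D0"
        using prototile_translates[of P D0 D] D0 \<T> P by blast
      with D show "D \<in> (\<lambda>v. shift_tile v D0) ` V" by (auto simp: V_def)
    qed
    ultimately show ?thesis by (meson finite_imageI finite_subset)
  next
    case False
    then have "{D\<in>x. D \<in> P \<and> D \<inter> K \<noteq> {}} = {}" by auto
    then show ?thesis by (simp only: finite.emptyI)
  qed
  then have "finite (\<Union>P\<in>\<T>. {D\<in>x. D \<in> P \<and> D \<inter> K \<noteq> {}})" using \<T> by blast
  moreover have "{D\<in>x. D \<inter> K \<noteq> {}} \<subseteq> (\<Union>P\<in>\<T>. {D\<in>x. D \<in> P \<and> D \<inter> K \<noteq> {}})"
    using x by (auto simp: packing_def)
  ultimately show ?thesis by (meson finite_subset)
qed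

text \<open>Only finitely many tiles come near \<open>p\<close>, so those among them that miss
  \<open>p\<close> have a closed union, which stays away from \<open>p\<close>.\<close>

lemma packing_local_star:
  assumes "packing \<T> x" "finite \<T>" "\<T> \<subseteq> prototiles"
  obtains e where "0 < e" "\<And>D. D \<in> x \<Longrightarrow> D \<inter> ball p e \<noteq> {} \<Longrightarrow> p \<in> D"
proof -
  define S where "S = {D\<in>x. D \<inter> ball p 1 \<noteq> {} \<and> p \<notin> D}"
  have "finite S"
    by (rule finite_subset[OF _ packing_locally_finite[OF assms bounded_ball[of p 1]]])
      (auto simp: S_def)
  moreover have "\<forall>D\<in>S. closed D"
    using assms(1) by (auto simp: S_def packing_def tile_def compact_imp_closed)
  ultimately have "closed (\<Union> S)" by blast
  moreover have "p \<in> - \<Union> S" by (auto simp: S_def)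
  ultimately obtain e where e: "0 < e" "ball p e \<subseteq> - \<Union> S"
    by (metis open_Compl open_contains_ball)
  show ?thesis
  proof
    show "0 < min e 1" using e by simp
    fix D assume "D \<in> x" "D \<inter> ball p (min e 1) \<noteq> {}"
    then obtain q where "q \<in> D" "q \<in> ball p e" "q \<in> ball p 1" by auto
    then show "p \<in> D" using e \<open>D \<in> x\<close> unfolding S_def by blast
  qed
qed

lemma star_is_patch:
  assumes x: "x \<in> tiling_space \<T>" and \<T>: "finite \<T>" "\<T> \<subseteq> prototiles"
    and K: "bounded K" "connected K" "K \<noteq> {}"
  shows "{D\<in>x. D \<inter> K \<noteq> {}} \<in> patches_covering \<T> x K"
proof -
  let ?y = "{D\<in>x. D \<inter> K \<noteq> {}}"
  have px: "packing \<T> x" "\<Union> x = UNIV" using x by (auto simp: tiling_space_iff)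
  have cover: "K \<subseteq> \<Union> ?y" using px(2) by blast
  \<comment> \<open>Enlarging every tile by \<open>K\<close> makes all pieces share the connected
    set \<open>K\<close>; the union is unchanged because the tiles cover \<open>K\<close>.\<close>
  have "connected (\<Union> (insert K ((\<lambda>D. K \<union> D) ` ?y)))"
  proof (rule connected_Union)
    show "\<Inter> (insert K ((\<union>) K ` ?y)) \<noteq> {}" using K by auto
  next
    fix S assume "S \<in> insert K ((\<union>) K ` ?y)"
    then show "connected S"
      using K(2) px(1) by (auto intro!: connected_Un simp: packing_def tile_def)
  qed
  moreover have "\<Union> (insert K ((\<lambda>D. K \<union> D) ` ?y)) = \<Union> ?y" using cover by auto
  ultimately have "connected (\<Union> ?y)" by simp
  moreover have "?y \<noteq> {}" using cover K(3) by blast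
  ultimately show ?thesis
    using cover x packing_locally_finite[OF px(1) \<T> K(1)]
    by (auto simp: patches_covering_def patch_def)
qed


section \<open>The tiling metric\<close>

definition matches ::
    "(real ^ 'd \<Rightarrow> real) \<Rightarrow> (real ^ 'd) set set set \<Rightarrow> real \<Rightarrow> (real ^ 'd) set set \<Rightarrow> (real ^ 'd) set set \<Rightarrow> bool" where
  "matches N \<T> r x y \<longleftrightarrow>
     (\<exists>x'\<in>patches_covering \<T> x (ncball0 N (1 / r)).
      \<exists>y'\<in>patches_covering \<T> y (ncball0 N (1 / r)).
      \<exists>v\<in>ncball0 N r. shift v x' = y')"

lemma patches_covering_mono:
  "K \<subseteq> L \<Longrightarrow> patches_covering \<T> x L \<subseteq> patches_covering \<T> x K"
  by (auto simp: patches_covering_def)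

lemma tiling_dist_pre_nonneg: "0 \<le> tiling_dist_pre N \<T> x y"
  unfolding tiling_dist_pre_def by (rule Inf_greatest) auto

text \<open>Below the cap the minimum is inactive, and an infimum lies below \<open>e\<close>
  exactly when a member does. The bound on \<open>e\<close> also supplies the bound on
  \<open>r\<close> built into \<open>tiling_dist_pre\<close>.\<close>

lemma tiling_dist_less_iff:
  assumes "0 < e" "e \<le> 1 / sqrt 2"
  shows "tiling_dist N \<T> x y < e \<longleftrightarrow> (\<exists>r. 0 < r \<and> r < e \<and> matches N \<T> r x y)"
proof -
  have "ereal (tiling_dist N \<T> x y) = min (ereal (1 / sqrt 2)) (tiling_dist_pre N \<T> x y)"
    using tiling_dist_pre_nonneg[of N \<T> x y]
    unfolding tiling_dist_def by (cases "tiling_dist_pre N \<T> x y") (auto simp: min_def)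
  then have "tiling_dist N \<T> x y < e \<longleftrightarrow> min (ereal (1 / sqrt 2)) (tiling_dist_pre N \<T> x y) < ereal e"
    by (metis less_ereal.simps(1))
  also have "\<dots> \<longleftrightarrow> tiling_dist_pre N \<T> x y < ereal e"
    using assms(2) by (auto simp: min_less_iff_disj)
  also have "\<dots> \<longleftrightarrow> (\<exists>r. 0 < r \<and> r < e \<and> matches N \<T> r x y)"
    unfolding tiling_dist_pre_def Inf_less_iff matches_def[symmetric]
    using assms(2) by (auto intro: less_le_trans)
  finally show ?thesis .
qed

lemma tiling_dist_nonneg: "0 \<le> tiling_dist N \<T> x y"
  using tiling_dist_pre_nonneg[of N \<T> x y]
  by (auto simp: tiling_dist_def intro!: real_of_ereal_pos)

lemma tiling_dist_le: "tiling_dist N \<T> x y \<le> 1 / sqrt 2"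
  using tiling_dist_pre_nonneg[of N \<T> x y]
  unfolding tiling_dist_def by (cases "tiling_dist_pre N \<T> x y") (auto simp: min_def)

text \<open>Clearing denominators leaves \<open>s * (r + s) < 1\<close>. In the triangle inequality
  this keeps a point of the ball of radius \<open>1 / (r + s)\<close> inside the ball of radius
  \<open>1 / s\<close> after a displacement of size at most \<open>r\<close>.\<close>

lemma radius_slack:
  fixes r s :: real
  assumes "0 < r" "0 < s" "r + s < 1 / sqrt 2"
  shows "1 / (r + s) + r < 1 / s"
proof -
  have "(r + s)\<^sup>2 < (1 / sqrt 2)\<^sup>2" using assms by (intro power_strict_mono) auto
  then have "(r + s) * (r + s) < 1" by (simp add: power2_eq_square)
  moreover have "s * (r + s) \<le> (r + s) * (r + s)" using assms by (intro mult_right_mono) auto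
  ultimately have "s * (r + s) < 1" by linarith
  then have "r * (s * (r + s)) < r * 1" using assms by (intro mult_strict_left_mono) auto
  then show ?thesis using assms by (simp add: field_simps)
qed

locale finite_prototiles =
  fixes N :: "real ^ 'd \<Rightarrow> real" and \<T> :: "(real ^ 'd) set set set"
  assumes norm: "is_norm N" and fin: "finite \<T>" and proto: "\<T> \<subseteq> prototiles"
begin

section \<open>Comparison of \<open>N\<close> with the Euclidean norm\<close>

lemma N_nonneg: "0 \<le> N p" and N_eq_0: "N p = 0 \<longleftrightarrow> p = 0"
  and N_scale: "N (c *\<^sub>R p) = \<bar>c\<bar> * N p" and N_add: "N (p + q) \<le> N p + N q"
  using norm by (auto simp: is_norm_def)

lemma N_0 [simp]: "N 0 = 0"
  by (simp add: N_eq_0)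

lemma N_minus [simp]: "N (- p) = N p"
  using N_scale[of "-1" p] by simp

lemma N_diff: "N (p - q) \<le> N p + N q"
  using N_add[of p "- q"] by simp

lemma N_le_norm:
  obtains C where "0 < C" "\<And>p. N p \<le> C * norm p"
proof
  define C where "C = (\<Sum>b\<in>Basis. N (b :: real ^ 'd)) + 1"
  have "0 \<le> (\<Sum>b\<in>Basis. N (b :: real ^ 'd))" by (intro sum_nonneg N_nonneg)
  then show "0 < C" by (simp add: C_def)
  fix p :: "real ^ 'd"
  have sum: "N (\<Sum>b\<in>B. f b) \<le> (\<Sum>b\<in>B. N (f b))" if "finite B"
    for B :: "(real ^ 'd) set" and f :: "real ^ 'd \<Rightarrow> real ^ 'd"
    using that
  proof induction
    case (insert b B)
    then show ?case using N_add[of "f b" "sum f B"] by simp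
  qed simp
  have "N p = N (\<Sum>b\<in>Basis. (p \<bullet> b) *\<^sub>R b)" by (simp add: euclidean_representation)
  also have "\<dots> \<le> (\<Sum>b\<in>Basis. N ((p \<bullet> b) *\<^sub>R b))" by (intro sum) simp
  also have "\<dots> \<le> (\<Sum>b\<in>Basis. norm p * N b)"
    unfolding N_scale by (intro sum_mono mult_right_mono Basis_le_norm N_nonneg)
  also have "\<dots> \<le> C * norm p" 
    unfolding C_def sum_distrib_left[symmetric] by (simp add: algebra_simps)
  finally show "N p \<le> C * norm p" .
qed

lemma continuous_on_N: "continuous_on S N"
proof -
  obtain C where C: "0 < C" "\<And>p. N p \<le> C * norm p" using N_le_norm by blast
  have "C-lipschitz_on S N"
  proof (rule lipschitz_onI)
    fix p q
    have "N p \<le> N (p - q) + N q" "N q \<le> N (q - p) + N p"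
      using N_add[of "p - q" q] N_add[of "q - p" p] by auto
    then show "dist (N p) (N q) \<le> C * dist p q"
      using C(2)[of "p - q"] C(2)[of "q - p"] by (auto simp: dist_norm norm_minus_commute)
  qed (use C in auto)
  then show ?thesis by (rule lipschitz_on_continuous_on)
qed

text \<open>\<open>N\<close> attains a positive minimum on the compact Euclidean unit sphere, and
  homogeneity extends the bound.\<close>

lemma norm_le_N:
  obtains m where "0 < m" "\<And>p. m * norm p \<le> N p"
proof -
  obtain b :: "real ^ 'd" where b: "b \<in> sphere 0 1" "\<And>p. p \<in> sphere 0 1 \<Longrightarrow> N b \<le> N p"
    using continuous_attains_inf[OF compact_sphere _ continuous_on_N, of "0 :: real ^ 'd" 1] by auto
  have "N b * norm p \<le> N p" for p
  proof (cases "p = 0")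
    case False
    then have "N b \<le> N ((1 / norm p) *\<^sub>R p)" by (intro b(2)) simp
    then show ?thesis using False by (simp add: N_scale field_simps)
  qed simp
  moreover have "0 < N b" using b(1) N_nonneg[of b] N_eq_0[of b] by (cases "b = 0") auto
  ultimately show ?thesis using that by blast
qed

lemma bounded_N: "(\<And>p. p \<in> S \<Longrightarrow> N p \<le> r) \<Longrightarrow> bounded S"
proof -
  obtain m where m: "0 < m" "\<And>p. m * norm p \<le> N p" using norm_le_N by blast
  assume "\<And>p. p \<in> S \<Longrightarrow> N p \<le> r"
  then have "norm p \<le> r / m" if "p \<in> S" for p
    using m(1) m(2)[of p] that by (fastforce simp: field_simps)
  then show "bounded S" by (auto simp: bounded_iff)
qed

lemma N_bounded:
  assumes "bounded S"
  obtains R where "0 < R" "\<And>p. p \<in> S \<Longrightarrow> N p < R"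
proof -
  obtain C where C: "0 < C" "\<And>p. N p \<le> C * norm p" using N_le_norm by blast
  obtain b where b: "0 < b" "\<And>p. p \<in> S \<Longrightarrow> norm p \<le> b" using assms bounded_pos by blast
  show ?thesis
  proof
    show "0 < C * b + 1" using C b by (simp add: add_pos_pos)
    fix p assume "p \<in> S"
    then have "C * norm p \<le> C * b" using b C by (intro mult_left_mono) auto
    then show "N p < C * b + 1" using C(2)[of p] by simp
  qed
qed

lemma open_N_ball: "open {p. N (p - c) < r}"
  by (intro open_Collect_less continuous_on_const continuous_on_compose2[OF continuous_on_N[of UNIV]]
      continuous_intros) auto

lemma bounded_ncball0: "bounded (ncball0 N r)"
  by (rule bounded_N[of _ r]) (simp add: ncball0_def)

lemma connected_ncball0: "connected (ncball0 N r)"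
proof (rule convex_connected, rule convexI)
  fix p q :: "real ^ 'd" and a b :: real
  assume *: "p \<in> ncball0 N r" "q \<in> ncball0 N r" "0 \<le> a" "0 \<le> b" "a + b = 1"
  have "N (a *\<^sub>R p + b *\<^sub>R q) \<le> a * N p + b * N q"
    using N_add[of "a *\<^sub>R p" "b *\<^sub>R q"] * by (simp add: N_scale)
  also have "\<dots> \<le> r" using * by (intro convex_bound_le) (auto simp: ncball0_def)
  finally show "a *\<^sub>R p + b *\<^sub>R q \<in> ncball0 N r" by (simp add: ncball0_def)
qed

lemma ncball0_nonempty: "0 \<le> r \<Longrightarrow> ncball0 N r \<noteq> {}"
  by (auto simp: ncball0_def intro: exI[of _ 0])

section \<open>Matching expressed through individual tiles\<close>

lemma matches_commute: "matches N \<T> r x y \<longleftrightarrow> matches N \<T> r y x"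
proof -
  have "matches N \<T> r y x" if "matches N \<T> r x y" for x y
  proof -
    from that obtain x' v where "x' \<in> patches_covering \<T> x (ncball0 N (1 / r))"
      "shift v x' \<in> patches_covering \<T> y (ncball0 N (1 / r))" "v \<in> ncball0 N r"
      unfolding matches_def by blast
    moreover have "shift (- v) (shift v x') = x'" by simp
    moreover have "- v \<in> ncball0 N r" using calculation by (simp add: ncball0_def)
    ultimately show ?thesis unfolding matches_def by blast
  qed
  then show ?thesis by blast
qed

lemma patches_covering_shift:
  assumes "y \<in> patches_covering \<T> x K" "shift v y \<subseteq> z" "z \<in> tiling_space \<T>" "L \<subseteq> shift_tile v K"
  shows "shift v y \<in> patches_covering \<T> z L"
  using assms unfolding patches_covering_def patch_def
  by (auto simp: Union_shift subset_iff) (auto simp: shift_def)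

text \<open>The patch of \<open>x\<close> consists of the tiles meeting \<open>K\<close> and is
  connected because \<open>K\<close> is. \<open>K\<close> contains the balls about \<open>0\<close>
  and about \<open>v\<close>, so both patches cover the ball about \<open>0\<close>. It is left free
  because composing two matches needs a set adapted to the total displacement.\<close>

lemma matchesI:
  assumes "x \<in> tiling_space \<T>" "y \<in> tiling_space \<T>" "0 < r" "N v \<le> r"
    and K: "bounded K" "connected K" "ncball0 N (1 / r) \<subseteq> K \<inter> shift_tile v K"
    and sub: "\<And>D. D \<in> x \<Longrightarrow> D \<inter> K \<noteq> {} \<Longrightarrow> shift_tile v D \<in> y"
  shows "matches N \<T> r x y"
proof -
  have "K \<noteq> {}" using K(3) ncball0_nonempty[of "1 / r"] assms(3) by fastforce
  then have st: "{D\<in>x. D \<inter> K \<noteq> {}} \<in> patches_covering \<T> x K"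
    by (intro star_is_patch assms(1) fin proto K)
  have "shift v {D\<in>x. D \<inter> K \<noteq> {}} \<in> patches_covering \<T> y (ncball0 N (1 / r))"
    using K(3) sub by (intro patches_covering_shift[OF st _ assms(2)]) (auto simp: shift_def)
  moreover have "{D\<in>x. D \<inter> K \<noteq> {}} \<in> patches_covering \<T> x (ncball0 N (1 / r))"
    using st K(3) patches_covering_mono by blast
  moreover have "v \<in> ncball0 N r" using assms(4) by (simp add: ncball0_def)
  ultimately show ?thesis unfolding matches_def by blast
qed

lemma matchesI_0:
  assumes "x \<in> tiling_space \<T>" "y \<in> tiling_space \<T>" "0 < r"
    and "{D\<in>x. D \<inter> ncball0 N (1 / r) \<noteq> {}} \<subseteq> y"
  shows "matches N \<T> r x y"
  using assms by (intro matchesI[of x y r 0 "ncball0 N (1 / r)"] bounded_ncball0 connected_ncball0) auto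

text \<open>By \<open>packing_absorb\<close>, the patch of \<open>x\<close> contains every tile
  meeting an open set that it covers. That set is the union of the ball about \<open>0\<close> and
  the ball about \<open>v\<close>, the preimage of the ball covered by the patch of
  \<open>y\<close>. Openness forces the strict inequalities.\<close>

lemma matchesE:
  assumes "matches N \<T> r x y" "x \<in> tiling_space \<T>"
  obtains v where "N v \<le> r"
    "\<And>D p. D \<in> x \<Longrightarrow> p \<in> D \<Longrightarrow> N p < 1 / r \<or> N (p - v) < 1 / r \<Longrightarrow> shift_tile v D \<in> y"
proof -
  from assms(1) obtain x' v where x': "x' \<in> patches_covering \<T> x (ncball0 N (1 / r))"
    and y': "shift v x' \<in> patches_covering \<T> y (ncball0 N (1 / r))" and v: "v \<in> ncball0 N r"
    unfolding matches_def by blast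
  define U where "U = {p. N (p - 0) < 1 / r} \<union> {p. N (p - v) < 1 / r}"
  have "open U" unfolding U_def by (intro open_Un open_N_ball)
  have "p \<in> \<Union> x'" if "N (p - v) < 1 / r" for p
  proof -
    have "p - v \<in> \<Union> (shift v x')"
      using that y' by (auto simp: patches_covering_def ncball0_def simp del: Union_iff)
    then show ?thesis by (simp add: Union_shift del: Union_iff)
  qed
  moreover have "p \<in> \<Union> x'" if "N p < 1 / r" for p
    using that x' by (auto simp: patches_covering_def ncball0_def simp del: Union_iff)
  ultimately have "U \<subseteq> \<Union> x'" by (auto simp: U_def simp del: Union_iff)
  show ?thesis
  proof
    show "N v \<le> r" using v by (simp add: ncball0_def)
    fix D p assume D: "D \<in> x" "p \<in> D" "N p < 1 / r \<or> N (p - v) < 1 / r"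
    have "D \<in> x'"
    proof (rule packing_absorb[OF _ _ _ \<open>open U\<close> \<open>U \<subseteq> \<Union> x'\<close> D(1)])
      show "packing \<T> x" using assms(2) by (simp add: tiling_space_iff)
      show "finite x'" "x' \<subseteq> x" using x' by (auto simp: patches_covering_def patch_def)
      show "D \<inter> U \<noteq> {}" using D by (auto simp: U_def)
    qed
    then show "shift_tile v D \<in> y" using y' by (auto simp: patches_covering_def shift_def)
  qed
qed

lemma matches_refl: "x \<in> tiling_space \<T> \<Longrightarrow> 0 < r \<Longrightarrow> matches N \<T> r x x"
  by (rule matchesI_0) auto

lemma matches_trans:
  assumes X: "x \<in> tiling_space \<T>" "y \<in> tiling_space \<T>" "z \<in> tiling_space \<T>"
    and m: "matches N \<T> r x y" "matches N \<T> s y z"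
    and rs: "0 < r" "0 < s" "r + s < 1 / sqrt 2"
  shows "matches N \<T> (r + s) x z"
proof -
  obtain v where v: "N v \<le> r"
    "\<And>D p. D \<in> x \<Longrightarrow> p \<in> D \<Longrightarrow> N p < 1 / r \<or> N (p - v) < 1 / r \<Longrightarrow> shift_tile v D \<in> y"
    using matchesE[OF m(1) X(1)] by blast
  obtain w where w: "N w \<le> s"
    "\<And>D p. D \<in> y \<Longrightarrow> p \<in> D \<Longrightarrow> N p < 1 / s \<or> N (p - w) < 1 / s \<Longrightarrow> shift_tile w D \<in> z"
    using matchesE[OF m(2) X(2)] by blast
  define R where "R = 1 / (r + s)"
  define B where "B = ncball0 N R"
  have Rs: "R + r < 1 / s" and Rr: "R + s < 1 / r"
    using radius_slack[of r s] radius_slack[of s r] rs by (auto simp: R_def add.commute)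
  have "(r + s)\<^sup>2 < (1 / sqrt 2)\<^sup>2" using rs by (intro power_strict_mono) auto
  then have "r + s \<le> R" using rs by (simp add: R_def power2_eq_square field_simps)
  have Nwv: "N (w + v) \<le> r + s" using N_add[of w v] v w by simp
  \<comment> \<open>The balls about \<open>0\<close> and \<open>w + v\<close> overlap because \<open>r + s < 1 / (r + s)\<close>; this keeps the
    common patch connected.\<close>
  define K where "K = B \<union> shift_tile (- (w + v)) B"
  show ?thesis
  proof (rule matchesI[of x z _ "w + v" K])
    show "bounded K"
    proof (rule bounded_N)
      fix p assume "p \<in> K"
      then have "N p \<le> R \<or> N (p - (w + v)) \<le> R" by (auto simp: K_def B_def ncball0_def algebra_simps)
      then show "N p \<le> R + (r + s)" using N_add[of "p - (w + v)" "w + v"] Nwv rs by auto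
    qed
    have "w + v \<in> B \<inter> shift_tile (- (w + v)) B"
      using Nwv \<open>r + s \<le> R\<close> rs by (auto simp: B_def ncball0_def)
    then show "connected K"
      unfolding K_def B_def by (intro connected_Un) (auto simp: connected_ncball0)
    show "ncball0 N (1 / (r + s)) \<subseteq> K \<inter> shift_tile (w + v) K"
      by (auto simp: K_def B_def R_def)
    fix D assume "D \<in> x" "D \<inter> K \<noteq> {}"
    then obtain p where p: "p \<in> D" "p \<in> K" by auto
    then have "N p \<le> R \<or> N (p - v - w) \<le> R" by (auto simp: K_def B_def ncball0_def algebra_simps)
    \<comment> \<open>If \<open>p\<close> is near \<open>0\<close>, then \<open>p - v\<close> is
      within \<open>R + r < 1 / s\<close> of \<open>0\<close>; if \<open>p\<close> is near
      \<open>w + v\<close>, then \<open>p\<close> is within \<open>R + s < 1 / r\<close> of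
      \<open>v\<close>. Either way both matches apply to the tile.\<close>
    then have "(N p < 1 / r \<or> N (p - v) < 1 / r) \<and> (N (p - v) < 1 / s \<or> N (p - v - w) < 1 / s)"
      using N_add[of "p - v - w" w] N_diff[of p v] Rs Rr v w rs by auto
    then have "shift_tile v D \<in> y" "p - v \<in> shift_tile v D"
      "N (p - v) < 1 / s \<or> N (p - v - w) < 1 / s"
      using v(2)[OF \<open>D \<in> x\<close> p(1)] p by auto
    then show "shift_tile (w + v) D \<in> z" using w(2)[of "shift_tile v D" "p - v"] by auto
  qed (use X rs Nwv in auto)
qed

text \<open>\<open>y\<close> contains copies of \<open>D\<close> displaced by arbitrarily small
  vectors. Those displaced little enough keep \<open>p\<close> in their interior, so they coincide
  in the packing \<open>y\<close>, and their common displacement must be \<open>0\<close>.\<close>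

lemma matches_all_subset:
  assumes X: "x \<in> tiling_space \<T>" "y \<in> tiling_space \<T>"
    and m: "\<And>e. 0 < e \<Longrightarrow> \<exists>r. 0 < r \<and> r < e \<and> matches N \<T> r x y"
  shows "x \<subseteq> y"
proof
  fix D assume D: "D \<in> x"
  have "tile D" using D X by (auto simp: tiling_space_iff packing_def)
  obtain p e where pe: "0 < e" "ball p e \<subseteq> interior D"
    using tile_interior_nonempty[OF \<open>tile D\<close>]
    by (metis all_not_in_conv open_contains_ball open_interior)
  have "p \<in> D" using pe interior_subset by fastforce
  obtain c where c: "0 < c" "\<And>p. c * norm p \<le> N p" using norm_le_N by blast
  have step: "\<exists>v. N v < d \<and> N v < c * e \<and> shift_tile v D \<in> y" if d: "0 < d" for d
  proof -
    \<comment> \<open>The three bounds keep the displacement below \<open>d\<close>, keep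
      \<open>p\<close> interior to the displaced tile, and put \<open>p\<close> into the matched
      ball.\<close>
    define d' where "d' = min d (min (c * e) (1 / (N p + 1)))"
    have "0 < d'" using d pe c N_nonneg[of p] by (auto simp: d'_def)
    then obtain r where r: "0 < r" "r < d'" "matches N \<T> r x y" using m by blast
    have "r < 1 / (N p + 1)" using r by (simp add: d'_def)
    then have "N p < 1 / r" using r N_nonneg[of p] by (simp add: field_simps)
    moreover obtain v where "N v \<le> r" "\<And>D p. D \<in> x \<Longrightarrow> p \<in> D \<Longrightarrow>
        N p < 1 / r \<or> N (p - v) < 1 / r \<Longrightarrow> shift_tile v D \<in> y"
      using matchesE[OF r(3) X(1)] by blast
    ultimately show ?thesis using r D \<open>p \<in> D\<close> by (auto simp: d'_def intro!: exI[of _ v])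
  qed
  have int: "p \<in> interior (shift_tile v D)" if "N v < c * e" for v
  proof -
    have "c * norm v < c * e" using that c(2)[of v] by simp
    then have "p + v \<in> ball p e" using c(1) by (simp add: dist_norm)
    then show ?thesis using pe by (auto simp: interior_shift_tile)
  qed
  obtain v where v: "N v < c * e" "shift_tile v D \<in> y" using step[of 1] by auto
  have "v = 0"
  proof (rule ccontr)
    assume "v \<noteq> 0"
    then have "0 < N v" using N_nonneg[of v] N_eq_0[of v] by simp
    then obtain w where w: "N w < N v" "N w < c * e" "shift_tile w D \<in> y" using step by blast
    have "packing \<T> y" using X by (simp add: tiling_space_iff)
    then have "shift_tile v D = shift_tile w D"
      by (rule packing_eqI[OF _ v(2) w(3) int[OF v(1)] int[OF w(2)]])
    then have "v = w" using shift_tile_vector_inj \<open>tile D\<close> by (auto simp: tile_def)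
    with w show False by simp
  qed
  with v show "D \<in> y" by simp
qed

section \<open>The metric axioms\<close>

lemma tiling_dist_commute: "tiling_dist N \<T> x y = tiling_dist N \<T> y x"
proof -
  have "tiling_dist_pre N \<T> x y = tiling_dist_pre N \<T> y x"
    using matches_commute[of _ x y] unfolding tiling_dist_pre_def matches_def by simp
  then show ?thesis by (simp add: tiling_dist_def)
qed

lemma Metric_space_tiling_dist: "Metric_space (tiling_space \<T>) (tiling_dist N \<T>)"
proof
  fix x y show "0 \<le> tiling_dist N \<T> x y" by (rule tiling_dist_nonneg)
  show "tiling_dist N \<T> x y = tiling_dist N \<T> y x" by (rule tiling_dist_commute)
next
  fix x y assume X: "x \<in> tiling_space \<T>" "y \<in> tiling_space \<T>"
  show "tiling_dist N \<T> x y = 0 \<longleftrightarrow> x = y"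
  proof
    assume 0: "tiling_dist N \<T> x y = 0"
    have *: "\<exists>r. 0 < r \<and> r < e \<and> matches N \<T> r x y" if "0 < e" for e
      using tiling_dist_less_iff[of "min e (1 / sqrt 2)" N \<T> x y] that 0 by auto
    then have "x \<subseteq> y" using X by (rule matches_all_subset[rotated 2])
    moreover have "y \<subseteq> x" using X * matches_commute by (intro matches_all_subset) blast+
    ultimately show "x = y" by blast
  next
    assume "x = y"
    show "tiling_dist N \<T> x y = 0"
    proof (rule ccontr)
      let ?e = "tiling_dist N \<T> x y"
      assume "?e \<noteq> 0"
      then have e: "0 < ?e" using tiling_dist_nonneg[of N \<T> x y] by simp
      \<comment> \<open>A tiling matches itself at every positive scale, in particular at half its
        alleged distance to itself.\<close>
      then have "matches N \<T> (?e / 2) x y" using matches_refl X \<open>x = y\<close> by simp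
      then have "?e < ?e"
        using tiling_dist_less_iff[OF e tiling_dist_le, of N \<T> x y] e by (auto intro!: exI[of _ "?e / 2"])
      then show False by simp
    qed
  qed
next
  fix x y z assume X: "x \<in> tiling_space \<T>" "y \<in> tiling_space \<T>" "z \<in> tiling_space \<T>"
  let ?d = "tiling_dist N \<T>"
  show "?d x z \<le> ?d x y + ?d y z"
  proof (rule ccontr)
    assume less: "\<not> ?thesis"
    \<comment> \<open>\<open>e\<close> splits the defect evenly, so scales below
      \<open>?d x y + e\<close> and \<open>?d y z + e\<close> add up to less than
      \<open>?d x z\<close>. Both thresholds respect the cap because \<open>?d x z\<close>
      does.\<close>
    define e where "e = (?d x z - ?d x y - ?d y z) / 2"
    have e: "0 < e" "?d x y + e + (?d y z + e) = ?d x z"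
      using less by (auto simp: e_def field_simps)
    note bounds = tiling_dist_nonneg[of N \<T> x y] tiling_dist_nonneg[of N \<T> y z]
      tiling_dist_le[of N \<T> x z]
    obtain r where r: "0 < r" "r < ?d x y + e" "matches N \<T> r x y"
      using tiling_dist_less_iff[of "?d x y + e" N \<T> x y] e bounds by auto
    obtain s where s: "0 < s" "s < ?d y z + e" "matches N \<T> s y z"
      using tiling_dist_less_iff[of "?d y z + e" N \<T> y z] e bounds by auto
    have "r + s < ?d x z" using r s e by linarith
    moreover have "matches N \<T> (r + s) x z"
      using matches_trans[OF X r(3) s(3)] r s calculation bounds by auto
    ultimately have "?d x z < ?d x z"
      using tiling_dist_less_iff[of "?d x z" N \<T> x z] r s bounds by (metis add_pos_pos less_trans)
    then show False by simp
  qed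
qed


section \<open>Orbit closures\<close>

lemma shift_in_tiling_space: "x \<in> tiling_space \<T> \<Longrightarrow> shift v x \<in> tiling_space \<T>"
  by (rule tiling_space_shift[OF _ proto])

lemma in_orbit_closure_iff:
  assumes "x \<in> tiling_space \<T>"
  shows "y \<in> orbit_closure N \<T> x \<longleftrightarrow> y \<in> tiling_space \<T> \<and>
    (\<forall>e>0. \<exists>u r. 0 < r \<and> r < e \<and> matches N \<T> r y (shift u x))"
proof -
  interpret Metric_space "tiling_space \<T>" "tiling_dist N \<T>" by (rule Metric_space_tiling_dist)
  have "y \<in> orbit_closure N \<T> x \<longleftrightarrow> y \<in> tiling_space \<T> \<and>
    (\<forall>e>0. \<exists>u. tiling_dist N \<T> y (shift u x) < e)"
    unfolding orbit_closure_def tiling_topology_def metric_closure_of orb_def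
    using shift_in_tiling_space[OF assms] by auto
  also have "(\<forall>e>0. \<exists>u. tiling_dist N \<T> y (shift u x) < e) \<longleftrightarrow>
      (\<forall>e>0. \<exists>u r. 0 < r \<and> r < e \<and> matches N \<T> r y (shift u x))" (is "?L \<longleftrightarrow> ?R")
  proof
    assume L: ?L
    show ?R
    proof (intro allI impI)
      fix e :: real assume "0 < e"
      then have e: "0 < min e (1 / sqrt 2)" by simp
      with L obtain u where "tiling_dist N \<T> y (shift u x) < min e (1 / sqrt 2)" by blast
      then show "\<exists>u r. 0 < r \<and> r < e \<and> matches N \<T> r y (shift u x)"
        unfolding tiling_dist_less_iff[OF e min.cobounded2] by auto
    qed
  next
    assume R: ?R
    show ?L
    proof (intro allI impI)
      fix e :: real assume "0 < e"
      then have e: "0 < min e (1 / sqrt 2)" by simp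
      with R obtain u r where "0 < r" "r < min e (1 / sqrt 2)" "matches N \<T> r y (shift u x)" by blast
      then have "tiling_dist N \<T> y (shift u x) < min e (1 / sqrt 2)"
        unfolding tiling_dist_less_iff[OF e min.cobounded2] by blast
      then show "\<exists>u. tiling_dist N \<T> y (shift u x) < e" by auto
    qed
  qed
  finally show ?thesis .
qed

text \<open>The ball of radius \<open>1 / r\<close> about \<open>0\<close> contains the ball of
  radius \<open>1 / s\<close> about \<open>v\<close>, so the translated patches still cover enough.
  Translations commute, so the displacement is unchanged.\<close>

lemma matches_shift:
  assumes "matches N \<T> r x y" "x \<in> tiling_space \<T>" "y \<in> tiling_space \<T>"
    and "r \<le> s" "1 / s + N v \<le> 1 / r"
  shows "matches N \<T> s (shift v x) (shift v y)"
proof -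
  from assms(1) obtain x' w where x': "x' \<in> patches_covering \<T> x (ncball0 N (1 / r))"
    and y': "shift w x' \<in> patches_covering \<T> y (ncball0 N (1 / r))" and w: "w \<in> ncball0 N r"
    unfolding matches_def by blast
  have "ncball0 N (1 / s) \<subseteq> shift_tile v (ncball0 N (1 / r))"
  proof
    fix p assume "p \<in> ncball0 N (1 / s)"
    then show "p \<in> shift_tile v (ncball0 N (1 / r))"
      using N_add[of p v] assms(5) by (simp add: ncball0_def)
  qed
  moreover have "x' \<subseteq> x" "shift w x' \<subseteq> y" using x' y' by (auto simp: patches_covering_def)
  ultimately have "shift v x' \<in> patches_covering \<T> (shift v x) (ncball0 N (1 / s))"
    "shift v (shift w x') \<in> patches_covering \<T> (shift v y) (ncball0 N (1 / s))"
    using patches_covering_shift[OF x', of v "shift v x"] patches_covering_shift[OF y', of v "shift v y"]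
      shift_in_tiling_space assms(2,3) unfolding shift_mono_iff by blast+
  moreover have "shift w (shift v x') = shift v (shift w x')" by (simp add: add.commute)
  moreover have "w \<in> ncball0 N s" using w assms(4) by (simp add: ncball0_def)
  ultimately show ?thesis unfolding matches_def by blast
qed

lemma orbit_closure_shift:
  assumes x: "x \<in> tiling_space \<T>" and y: "y \<in> orbit_closure N \<T> x"
  shows "shift v y \<in> orbit_closure N \<T> x"
  unfolding in_orbit_closure_iff[OF x]
proof (intro conjI allI impI)
  have Y: "y \<in> tiling_space \<T>" using y in_orbit_closure_iff[OF x] by blast
  then show "shift v y \<in> tiling_space \<T>" by (rule shift_in_tiling_space)
  fix e :: real assume "0 < e"
  define s where "s = e / 2"
  have "0 < s" "s < e" using \<open>0 < e\<close> by (auto simp: s_def)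
  \<comment> \<open>A scale \<open>r\<close> below this value leaves
    \<open>1 / s + N v <= 1 / r\<close>, the room that \<open>matches_shift\<close> needs for
    translating by \<open>v\<close>.\<close>
  have d: "0 < 1 / (1 / s + N v)" using \<open>0 < s\<close> N_nonneg[of v] by (simp add: add_pos_nonneg)
  then obtain u r where r: "0 < r" "r < 1 / (1 / s + N v)" "matches N \<T> r y (shift u x)"
    using y in_orbit_closure_iff[OF x] by blast
  have pos: "0 < 1 / s + N v" using \<open>0 < s\<close> N_nonneg[of v] by (simp add: add_pos_nonneg)
  have "1 / s + N v \<le> 1 / r" using r pos by (simp add: pos_less_divide_eq pos_le_divide_eq mult.commute)
  moreover have "r \<le> s"
  proof -
    have "1 / s \<le> 1 / r" using calculation N_nonneg[of v] by linarith
    then show ?thesis using r \<open>0 < s\<close> by (simp add: field_simps)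
  qed
  ultimately have "matches N \<T> s (shift v y) (shift v (shift u x))"
    using matches_shift[OF r(3) Y shift_in_tiling_space[OF x]] by simp
  then show "\<exists>u r. 0 < r \<and> r < e \<and> matches N \<T> r (shift v y) (shift u x)"
    using \<open>0 < s\<close> \<open>s < e\<close> by auto
qed

lemma orbit_closure_subset:
  assumes x: "x \<in> tiling_space \<T>" and y: "y \<in> orbit_closure N \<T> x"
  shows "orbit_closure N \<T> y \<subseteq> orbit_closure N \<T> x"
  unfolding orbit_closure_def[of _ _ y]
proof (rule closure_of_minimal)
  show "orb y \<subseteq> orbit_closure N \<T> x" using orbit_closure_shift[OF x y] by (auto simp: orb_def)
  show "closedin (tiling_topology N \<T>) (orbit_closure N \<T> x)" by (simp add: orbit_closure_def)
qed

text \<open>An orbit closure is closed and invariant, so only the equality of hulls is at stake;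
  \<open>orbit_closure_subset\<close> reduces it to mutual membership of \<open>x\<close> and
  \<open>y\<close>.\<close>

lemma minimal_set_orbit_closure_iff:
  assumes x: "x \<in> tiling_space \<T>"
  shows "minimal_set N \<T> (orbit_closure N \<T> x) \<longleftrightarrow>
    (\<forall>y\<in>orbit_closure N \<T> x. x \<in> orbit_closure N \<T> y)"
proof
  have "x \<in> orbit_closure N \<T> x"
    unfolding in_orbit_closure_iff[OF x]
    using x matches_refl by (metis dense shift_0)
  then show "minimal_set N \<T> (orbit_closure N \<T> x) \<Longrightarrow>
    \<forall>y\<in>orbit_closure N \<T> x. x \<in> orbit_closure N \<T> y"
    unfolding minimal_set_def by blast
next
  assume *: "\<forall>y\<in>orbit_closure N \<T> x. x \<in> orbit_closure N \<T> y"
  have "orbit_closure N \<T> y = orbit_closure N \<T> x" if y: "y \<in> orbit_closure N \<T> x" for y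
  proof (rule subset_antisym)
    show "orbit_closure N \<T> y \<subseteq> orbit_closure N \<T> x" by (rule orbit_closure_subset[OF x y])
    have "y \<in> tiling_space \<T>" using y unfolding in_orbit_closure_iff[OF x] by blast
    then show "orbit_closure N \<T> x \<subseteq> orbit_closure N \<T> y" using * y by (intro orbit_closure_subset) auto
  qed
  then show "minimal_set N \<T> (orbit_closure N \<T> x)"
    using orbit_closure_shift[OF x] closedin_closure_of
    unfolding minimal_set_def orbit_closure_def[of _ _ x] by blast
qed

section \<open>Repetitivity implies minimality\<close>

lemma repetitive_imp_minimal:
  assumes x: "x \<in> tiling_space \<T>" and rep: "repetitive N \<T> x"
  shows "minimal_set N \<T> (orbit_closure N \<T> x)"
  unfolding minimal_set_orbit_closure_iff[OF x]
proof
  fix y assume y: "y \<in> orbit_closure N \<T> x"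
  then have Y: "y \<in> tiling_space \<T>" using in_orbit_closure_iff[OF x] by blast
  show "x \<in> orbit_closure N \<T> y"
    unfolding in_orbit_closure_iff[OF Y]
  proof (intro conjI allI impI x)
    fix e :: real assume "0 < e"
    define r where "r = e / 2"
    have "0 < r" "r < e" using \<open>0 < e\<close> by (auto simp: r_def)
    define x' where "x' = {D\<in>x. D \<inter> ncball0 N (1 / r) \<noteq> {}}"
    have "x' \<in> patches_covering \<T> x (ncball0 N (1 / r))"
      unfolding x'_def using \<open>0 < r\<close>
      by (intro star_is_patch x fin proto bounded_ncball0 connected_ncball0 ncball0_nonempty) simp
    then have "patch \<T> x' \<and> x' \<subseteq> x" by (simp add: patches_covering_def)
    then obtain R where R: "0 < R" "\<And>t. \<exists>s. shift s x' \<subseteq> x \<and> \<Union> (shift s x') \<subseteq> nball N t R"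
      using rep unfolding repetitive_def by blast
    \<comment> \<open>As \<open>R < 1 / q\<close>, the matched ball of \<open>shift u x\<close>
      contains the translate of \<open>nball N u R\<close>, in which repetitivity places a copy of
      \<open>x'\<close>.\<close>
    obtain u q where q: "0 < q" "q < 1 / R" "matches N \<T> q y (shift u x)"
      using y R(1) unfolding in_orbit_closure_iff[OF x] by (meson zero_less_divide_1_iff)
    have "R < 1 / q" using q R(1) by (simp add: field_simps)
    have "matches N \<T> q (shift u x) y" using q(3) by (simp only: matches_commute[of q y])
    then obtain w where "N w \<le> q" and w: "\<And>D p. D \<in> shift u x \<Longrightarrow> p \<in> D \<Longrightarrow>
        N p < 1 / q \<or> N (p - w) < 1 / q \<Longrightarrow> shift_tile w D \<in> y"
      using matchesE shift_in_tiling_space[OF x] by blast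
    obtain s where s: "shift s x' \<subseteq> x" "\<Union> (shift s x') \<subseteq> nball N u R" using R(2) by blast
    \<comment> \<open>\<open>s\<close> locates the copy of \<open>x'\<close> in \<open>x\<close>
      near \<open>u\<close>, \<open>u\<close> moves it to the origin, and \<open>w\<close> carries
      it into \<open>y\<close>.\<close>
    have "shift_tile (w + (u + s)) D \<in> y" if D: "D \<in> x'" for D
    proof -
      have "shift_tile s D \<in> shift s x'" using D by (simp add: shift_def)
      then have sD: "shift_tile (u + s) D \<in> shift u x" using s(1) by (auto simp: mem_shift)
      have "D \<noteq> {}" using D by (auto simp: x'_def)
      then obtain p where "p \<in> D" by blast
      then have "p - s \<in> \<Union> (shift s x')" using D by (auto simp: Union_shift)
      then have "N (p - s - u) < 1 / q" using s(2) \<open>R < 1 / q\<close> by (auto simp: nball_def)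
      moreover have "p - s - u \<in> shift_tile (u + s) D" using \<open>p \<in> D\<close> by simp
      ultimately show ?thesis using w[OF sD] by fastforce
    qed
    then have "shift (w + (u + s)) x' \<subseteq> y" by (auto simp: shift_def)
    then have "x' \<subseteq> shift (- (w + (u + s))) y" unfolding shift_subset_iff .
    then have "matches N \<T> r x (shift (- (w + (u + s))) y)"
      using \<open>0 < r\<close> by (intro matchesI_0 x shift_in_tiling_space Y) (auto simp: x'_def)
    then show "\<exists>u r. 0 < r \<and> r < e \<and> matches N \<T> r x (shift u y)"
      using \<open>0 < r\<close> \<open>r < e\<close> by blast
  qed
qed


section \<open>Limits of translates under finite local complexity\<close>

text \<open>\<open>E\<close> and a neighbour \<open>F\<close> form, up to translation, a two-tile
  patch of \<open>x\<close>. Finite local complexity leaves finitely many representatives. In each,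
  \<open>E\<close> is a translate of one of the two tiles, by a vector unique for that tile, and
  this determines \<open>F\<close>.\<close>

lemma finite_neighbours:
  assumes x: "x \<in> tiling_space \<T>" and flc: "finite_local_complexity \<T> x"
  shows "finite {F. F \<noteq> E \<and> F \<inter> E \<noteq> {} \<and> (\<exists>v. E \<in> shift v x \<and> F \<in> shift v x)}" (is "finite ?A")
proof (cases "tile E")
  case True
  define Q where "Q = {y. patch \<T> y \<and> y \<subseteq> x \<and> card y = 2} // patch_rel \<T>"
  define G where "G = (\<lambda>c. {F. F \<noteq> E \<and> (\<exists>w. {E, F} = shift w (SOME y. y \<in> c))})"
  have "finite Q" using flc by (simp add: Q_def finite_local_complexity_def)
  have "?A \<subseteq> (\<Union>c\<in>{c\<in>Q. card (SOME y. y \<in> c) = 2}. G c)"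
  proof
    fix F assume "F \<in> ?A"
    then obtain v where F: "F \<noteq> E" "F \<inter> E \<noteq> {}" and v: "E \<in> shift v x" "F \<in> shift v x" by auto
    define y where "y = shift (- v) {E, F}"
    have y2: "y = {shift_tile (- v) E, shift_tile (- v) F}" by (simp add: y_def shift_def)
    have "y \<subseteq> x" using v by (auto simp: y_def shift_subset_iff)
    have "tile F" using v(2) shift_in_tiling_space[OF x] by (auto simp: tiling_space_iff packing_def)
    then have "connected (E \<union> F)" using F True by (intro connected_Un) (auto simp: tile_def)
    then have "connected (\<Union> y)" by (simp add: y_def Union_shift)
    then have "patch \<T> y" using x \<open>y \<subseteq> x\<close> by (auto simp: patch_def y2)
    have "card y = 2" using F(1) inj_shift_tile[of "- v"] by (auto simp: y2 card_2_iff inj_eq)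
    define c where "c = patch_rel \<T> `` {y}"
    have "c \<in> Q" using \<open>patch \<T> y\<close> \<open>y \<subseteq> x\<close> \<open>card y = 2\<close> by (auto simp: Q_def c_def intro: quotientI)
    have "y \<in> c" using \<open>patch \<T> y\<close> by (auto simp: c_def patch_rel_def intro: exI[of _ 0])
    then have "(SOME y. y \<in> c) \<in> c" by (rule someI)
    then obtain w where w: "(SOME y. y \<in> c) = shift w y" by (auto simp: c_def patch_rel_def)
    then have "{E, F} = shift (v - w) (SOME y. y \<in> c)" by (simp add: y_def)
    then have "F \<in> G c" using F(1) by (auto simp: G_def)
    moreover have "card (shift w y) = card y"
      by (simp add: shift_def card_image inj_on_subset[OF inj_shift_tile])
    ultimately show "F \<in> (\<Union>c\<in>{c\<in>Q. card (SOME y. y \<in> c) = 2}. G c)"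
      using \<open>c \<in> Q\<close> \<open>card y = 2\<close> w by auto
  qed
  moreover have "finite (G c)" if c: "card (SOME y. y \<in> c) = 2" for c
  proof -
    obtain A B where AB: "(SOME y. y \<in> c) = {A, B}"
      using iffD1[OF card_2_iff c] by (elim exE conjE)
    have fin: "finite {w. E = shift_tile w D}" for D
    proof (cases "\<exists>w. E = shift_tile w D")
      case T: True
      then have "tile D" using \<open>tile E\<close> by auto
      from T obtain w where "E = shift_tile w D" by blast
      then have "{w. E = shift_tile w D} \<subseteq> {w}"
        using shift_tile_vector_inj[of D] \<open>tile D\<close> by (auto simp: tile_def)
      then show ?thesis by (rule finite_subset) simp
    qed simp
    define W where "W = {w. E = shift_tile w A} \<union> {w. E = shift_tile w B}"
    have "G c \<subseteq> (\<lambda>w. shift_tile w A) ` W \<union> (\<lambda>w. shift_tile w B) ` W"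
      unfolding G_def AB W_def shift_def by (auto simp: doubleton_eq_iff)
    moreover have "finite W" using fin by (simp add: W_def)
    ultimately show ?thesis by (meson finite_UnI finite_imageI finite_subset)
  qed
  ultimately show ?thesis using \<open>finite Q\<close> by (rule_tac finite_subset) auto
next
  case False
  then have "?A = {}" using shift_in_tiling_space[OF x] by (auto simp: tiling_space_iff packing_def)
  then show ?thesis by (simp only: finite.emptyI)
qed

text \<open>\<open>A\<close> holds one representative per prototile. Some \<open>w\<close> moves the
  tile of \<open>shift t x\<close> over the origin onto its representative; then \<open>- w\<close>
  lies in that representative, which bounds \<open>N w\<close> uniformly in
  \<open>t\<close>.\<close>

lemma anchored_translates:
  assumes x: "x \<in> tiling_space \<T>"
  obtains A C where "finite A" "\<And>t. \<exists>w. N w \<le> C \<and> A \<inter> shift (w + t) x \<noteq> {}"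
proof -
  define rep where "rep = (\<lambda>P :: (real ^ 'd) set set. SOME D. D \<in> P)"
  define A where "A = {D \<in> rep ` \<T>. tile D}"
  have "finite A" using fin by (simp add: A_def)
  moreover have "\<forall>D\<in>A. bounded D" by (simp add: A_def tile_def compact_imp_bounded)
  ultimately have "bounded (\<Union> A)" by (intro bounded_Union) auto
  then obtain C where C: "\<And>p. p \<in> \<Union> A \<Longrightarrow> N p < C" using N_bounded by blast
  have "\<exists>w. N w \<le> C \<and> A \<inter> shift (w + t) x \<noteq> {}" for t
  proof -
    have tx: "packing \<T> (shift t x)" "\<Union> (shift t x) = UNIV"
      using shift_in_tiling_space[OF x] by (auto simp: tiling_space_iff)
    then obtain D where D: "D \<in> shift t x" "0 \<in> D" by blast
    then obtain P where P: "P \<in> \<T>" "D \<in> P" and "tile D" using tx(1) by (auto simp: packing_def)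
    have "rep P \<in> P" using P(2) unfolding rep_def by (rule someI)
    then obtain w where w: "rep P = shift_tile w D"
      using prototile_translates[of P D "rep P"] P proto by auto
    then have "rep P \<in> A" using P(1) \<open>tile D\<close> by (auto simp: A_def w[symmetric]) (simp add: w)
    moreover have "- w \<in> rep P" using D(2) w by simp
    ultimately have "N w \<le> C" using C[of "- w"] by fastforce
    moreover have "rep P \<in> shift (w + t) x" using D(1) w by (auto simp: shift_def)
    ultimately show ?thesis using \<open>rep P \<in> A\<close> by blast
  qed
  with \<open>finite A\<close> show ?thesis using that by blast
qed

end

text \<open>Subsets are points of a product of two-point spaces, compact by Tychonoff's theorem. The
  index type may be uncountable, so a cluster point replaces a convergent subsequence: the late
  indices \<open>n\<close> that agree with \<open>Z\<close> on \<open>A\<close> depend on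
  \<open>A\<close>.\<close>

lemma set_sequence_cluster_point:
  fixes z :: "nat \<Rightarrow> 'a set"
  obtains Z where "\<And>A m. finite A \<Longrightarrow> \<exists>n\<ge>m. z n \<inter> A = Z \<inter> A"
proof -
  define K :: "('a \<Rightarrow> real) set" where "K = PiE UNIV (\<lambda>_. {0, 1})"
  define f :: "nat \<Rightarrow> 'a \<Rightarrow> real" where "f n = indicator (z n)" for n
  have "compactin (product_topology (\<lambda>_. euclidean) UNIV) K"
    unfolding K_def compactin_PiE by auto
  then have "compact K" by (simp add: euclidean_product_topology)
  moreover have "eventually (\<lambda>g. g \<in> K) (filtermap f sequentially)"
    unfolding eventually_filtermap K_def f_def
    by (intro always_eventually) (auto simp: indicator_def)
  moreover have "filtermap f sequentially \<noteq> bot" by (simp add: filtermap_bot_iff)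
  ultimately obtain g where g: "inf (nhds g) (filtermap f sequentially) \<noteq> bot"
    unfolding compact_filter by blast
  show ?thesis
  proof
    fix A :: "'a set" and m :: nat
    assume "finite A"
    have ev: "eventually (\<lambda>h. \<bar>h a - g a\<bar> < 1 / 2) (nhds g)" for a
    proof -
      have "open {h :: 'a \<Rightarrow> real. \<bar>h a - g a\<bar> < 1 / 2}"
        by (intro open_Collect_less continuous_intros continuous_on_product_coordinates)
      then show ?thesis
        unfolding eventually_nhds
        by (metis (mono_tags) abs_zero diff_self half_gt_zero_iff mem_Collect_eq zero_less_one)
    qed
    have "eventually (\<lambda>h. \<forall>a\<in>A. \<bar>h a - g a\<bar> < 1 / 2) (nhds g)"
      using ev \<open>finite A\<close> by (simp add: eventually_ball_finite_distrib)
    moreover have "eventually (\<lambda>h. \<exists>n\<ge>m. h = f n) (filtermap f sequentially)"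
      unfolding eventually_filtermap eventually_sequentially by blast
    ultimately have "eventually (\<lambda>h. (\<forall>a\<in>A. \<bar>h a - g a\<bar> < 1 / 2) \<and> (\<exists>n\<ge>m. h = f n))
        (inf (nhds g) (filtermap f sequentially))"
      unfolding eventually_inf by blast
    note eventually_happens'[OF g this]
    then obtain h where "\<forall>a\<in>A. \<bar>h a - g a\<bar> < 1 / 2" "\<exists>n\<ge>m. h = f n"
      by blast
    then obtain n where n: "n \<ge> m" "\<forall>a\<in>A. \<bar>f n a - g a\<bar> < 1 / 2" by blast
    \<comment> \<open>Values of \<open>f n\<close> are \<open>0\<close> or \<open>1\<close>, so an
      error below \<open>1 / 2\<close> lets the threshold \<open>g a > 1 / 2\<close> recover
      \<open>z n\<close> on \<open>A\<close>; this threshold defines \<open>Z\<close>.\<close>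
    have "a \<in> z n \<longleftrightarrow> a \<in> {a. g a > 1 / 2}" if "a \<in> A" for a
      using bspec[OF n(2) that] by (cases "a \<in> z n") (auto simp: f_def abs_if split: if_splits)
    then show "\<exists>n\<ge>m. z n \<inter> A = {a. g a > 1 / 2} \<inter> A" using n(1) by blast
  qed
qed

context finite_prototiles
begin

text \<open>The set \<open>A\<close> keeps the sequence from escaping, so that the cluster point is nonempty.\<close>

lemma cluster_point_tiling:
  fixes z :: "nat \<Rightarrow> (real ^ 'd) set set"
  assumes x: "x \<in> tiling_space \<T>" and flc: "finite_local_complexity \<T> x"
    and z: "\<And>n. z n \<in> orb x"
    and A: "finite A" "\<And>n. A \<inter> z n \<noteq> {}"
    and Z: "\<And>A m. finite A \<Longrightarrow> \<exists>n\<ge>m. z n \<inter> A = Z \<inter> A"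
  shows "Z \<in> tiling_space \<T>"
proof -
  have zX: "z n \<in> tiling_space \<T>" for n
    using z[of n] shift_in_tiling_space[OF x] by (auto simp: orb_def)
  \<comment> \<open>The packing conditions involve at most two tiles at a time, so they pass from
    the \<open>z n\<close> to \<open>Z\<close>.\<close>
  have common: "\<exists>n. B \<subseteq> z n" if "finite B" "B \<subseteq> Z" for B
    using Z[OF that(1), of 0] that(2) by blast
  have pZ: "packing \<T> Z"
    unfolding packing_def pairwise_def
  proof (intro conjI ballI impI)
    fix D assume "D \<in> Z"
    then obtain n where "D \<in> z n" using common[of "{D}"] by auto
    then show "tile D" "\<exists>P\<in>\<T>. D \<in> P" using zX[of n] by (auto simp: tiling_space_iff packing_def)
  next
    fix D E assume "D \<in> Z" "E \<in> Z" "D \<noteq> E"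
    then obtain n where "D \<in> z n" "E \<in> z n" using common[of "{D, E}"] by auto
    then show "interior D \<inter> interior E = {}"
      using zX[of n] \<open>D \<noteq> E\<close> by (auto simp: tiling_space_iff packing_def pairwise_def)
  qed
  \<comment> \<open>The neighbours of \<open>E\<close> in all translates of \<open>x\<close> form a finite set, so for some \<open>n\<close>
    the star of \<open>E\<close> in \<open>z n\<close> lies in \<open>Z\<close>.\<close>
  have "open (\<Union> Z)"
    unfolding open_contains_ball
  proof
    fix p assume "p \<in> \<Union> Z"
    then obtain E where E: "E \<in> Z" "p \<in> E" by blast
    define B where "B = insert E {F. F \<noteq> E \<and> F \<inter> E \<noteq> {} \<and> (\<exists>v. E \<in> shift v x \<and> F \<in> shift v x)}"
    have "finite B" using finite_neighbours[OF x flc] by (simp add: B_def)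
    then obtain n where n: "z n \<inter> B = Z \<inter> B" using Z by blast
    then have "E \<in> z n" using E by (auto simp: B_def)
    have zn: "packing \<T> (z n)" "\<Union> (z n) = UNIV" using zX[of n] by (auto simp: tiling_space_iff)
    obtain e where e: "0 < e" "\<And>D. D \<in> z n \<Longrightarrow> D \<inter> ball p e \<noteq> {} \<Longrightarrow> p \<in> D"
      using packing_local_star[OF zn(1) fin proto] by blast
    obtain v where v: "z n = shift v x" using z[of n] by (auto simp: orb_def)
    have "ball p e \<subseteq> \<Union> Z"
    proof
      fix q assume q: "q \<in> ball p e"
      obtain F where F: "F \<in> z n" "q \<in> F" using zn(2) by blast
      then have "p \<in> F" using e(2) q by blast
      then have "F \<in> B" using F(1) E(2) \<open>E \<in> z n\<close> v by (auto simp: B_def)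
      then show "q \<in> \<Union> Z" using n F by blast
    qed
    then show "\<exists>e>0. ball p e \<subseteq> \<Union> Z" using e(1) by blast
  qed
  \<comment> \<open>A tile of \<open>Z\<close> meeting a small enough ball about \<open>p\<close>
    would contain \<open>p\<close>.\<close>
  moreover have "closed (\<Union> Z)"
    unfolding closed_def open_contains_ball
  proof
    fix p assume p: "p \<in> - \<Union> Z"
    obtain e where "0 < e" "\<And>D. D \<in> Z \<Longrightarrow> D \<inter> ball p e \<noteq> {} \<Longrightarrow> p \<in> D"
      using packing_local_star[OF pZ fin proto] by blast
    then show "\<exists>e>0. ball p e \<subseteq> - \<Union> Z" using p by blast
  qed
  ultimately have "\<Union> Z = {} \<or> \<Union> Z = UNIV" using clopen[of "\<Union> Z"] by blast
  moreover have "\<Union> Z \<noteq> {}"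
  proof -
    obtain n where "z n \<inter> A = Z \<inter> A" using Z[OF A(1)] by blast
    then obtain D where "D \<in> Z" using A(2)[of n] by blast
    then show ?thesis using pZ by (auto simp: packing_def tile_def)
  qed
  ultimately show ?thesis using pZ by (simp only: tiling_space_iff simp_thms)
qed

section \<open>Minimality implies repetitivity under finite local complexity\<close>

lemma minimal_imp_repetitive:
  assumes x: "x \<in> tiling_space \<T>" and flc: "finite_local_complexity \<T> x"
    and min: "minimal_set N \<T> (orbit_closure N \<T> x)"
  shows "repetitive N \<T> x"
proof (rule ccontr)
  assume not_rep: "\<not> ?thesis"
  obtain x' where x': "patch \<T> x'" "x' \<subseteq> x"
    and no: "\<not> (\<exists>r>0. \<forall>t. \<exists>s. shift s x' \<subseteq> x \<and> \<Union> (shift s x') \<subseteq> nball N t r)"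
    using not_rep[unfolded repetitive_def not_all not_imp] by (elim exE conjE)
  have "\<forall>n. \<exists>t. \<forall>s. \<not> (shift s x' \<subseteq> x \<and> \<Union> (shift s x') \<subseteq> nball N t (real (Suc n)))"
  proof
    fix n
    show "\<exists>t. \<forall>s. \<not> (shift s x' \<subseteq> x \<and> \<Union> (shift s x') \<subseteq> nball N t (real (Suc n)))"
      using no of_nat_0_less_iff[of "Suc n"] by (meson zero_less_Suc)
  qed
  then obtain t where t: "\<And>n s. \<not> (shift s x' \<subseteq> x \<and> \<Union> (shift s x') \<subseteq> nball N (t n) (real (Suc n)))"
    by metis
  obtain A C where A: "finite A" "\<And>t. \<exists>w. N w \<le> C \<and> A \<inter> shift (w + t) x \<noteq> {}"
    using anchored_translates[OF x] by blast
  from A(2) have "\<forall>n. \<exists>w. N w \<le> C \<and> A \<inter> shift (w + t n) x \<noteq> {}" by blast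
  then obtain w where w: "\<And>n. N (w n) \<le> C" "\<And>n. A \<inter> shift (w n + t n) x \<noteq> {}" by metis
  \<comment> \<open>\<open>z n\<close> views \<open>x\<close> from the bad centre
    \<open>t n\<close>, up to the bounded correction \<open>w n\<close> that brings in a tile of
    \<open>A\<close>.\<close>
  define z where "z n = shift (w n + t n) x" for n
  obtain Z where Z: "\<And>A m. finite A \<Longrightarrow> \<exists>n\<ge>m. z n \<inter> A = Z \<inter> A"
    using set_sequence_cluster_point[of z] by blast
  have ZX: "Z \<in> tiling_space \<T>"
    using cluster_point_tiling[OF x flc _ A(1) _ Z] w(2) by (auto simp: z_def orb_def)
  have "Z \<in> orbit_closure N \<T> x"
    unfolding in_orbit_closure_iff[OF x]
  proof (intro conjI allI impI ZX)
    fix e :: real assume "0 < e"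
    define B where "B = {D\<in>Z. D \<inter> ncball0 N (1 / (e / 2)) \<noteq> {}}"
    have "finite B"
      unfolding B_def using ZX
      by (intro packing_locally_finite[OF _ fin proto bounded_ncball0]) (simp add: tiling_space_iff)
    then obtain n where "z n \<inter> B = Z \<inter> B" using Z by blast
    then have "B \<subseteq> z n" by (auto simp: B_def)
    then have "matches N \<T> (e / 2) Z (z n)"
      using \<open>0 < e\<close> unfolding B_def z_def
      by (intro matchesI_0 ZX shift_in_tiling_space x) auto
    then show "\<exists>u r. 0 < r \<and> r < e \<and> matches N \<T> r Z (shift u x)"
      using \<open>0 < e\<close> unfolding z_def by (intro exI[of _ "w n + t n"] exI[of _ "e / 2"]) auto
  qed
  then have "x \<in> orbit_closure N \<T> Z" using min minimal_set_orbit_closure_iff[OF x] by blast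
  have "finite x'" using x'(1) by (simp add: patch_def)
  moreover have tiles: "\<forall>D\<in>x'. tile D" using x x'(2) by (auto simp: tiling_space_iff packing_def)
  ultimately have "bounded (\<Union> x')" by (intro bounded_Union) (auto simp: tile_def compact_imp_bounded)
  then obtain R where R: "0 < R" "\<And>p. p \<in> \<Union> x' \<Longrightarrow> N p < R" using N_bounded by blast
  \<comment> \<open>The bound \<open>r < 1 / R\<close> puts all of \<open>x'\<close> into the
    matched ball, so \<open>Z\<close> contains a whole copy of it.\<close>
  obtain u r where r: "0 < r" "r < 1 / R" "matches N \<T> r x (shift u Z)"
    using \<open>x \<in> orbit_closure N \<T> Z\<close> R(1) unfolding in_orbit_closure_iff[OF ZX]
    by (meson zero_less_divide_1_iff)
  have "R < 1 / r" using r R(1) by (simp add: field_simps)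
  obtain v where "N v \<le> r" and v: "\<And>D p. D \<in> x \<Longrightarrow> p \<in> D \<Longrightarrow>
      N p < 1 / r \<or> N (p - v) < 1 / r \<Longrightarrow> shift_tile v D \<in> shift u Z"
    using matchesE[OF r(3) x] by blast
  define s where "s = v - u"
  have "shift v x' \<subseteq> shift u Z"
  proof -
    have "shift_tile v D \<in> shift u Z" if D: "D \<in> x'" for D
    proof -
      obtain p where "p \<in> D" using tiles D by (auto simp: tile_def)
      then have "N p < 1 / r" using R(2)[of p] D \<open>R < 1 / r\<close> by force
      then show ?thesis using v[of D p] D x'(2) \<open>p \<in> D\<close> by blast
    qed
    then show ?thesis by (auto simp: shift_def)
  qed
  then have sZ: "shift s x' \<subseteq> Z"
    using shift_subset_iff[of "- u" "shift v x'" Z] by (simp add: s_def)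
  \<comment> \<open>Carried back to \<open>x\<close> through \<open>z n\<close>, the copy of
    \<open>x'\<close> at \<open>s\<close> in \<open>Z\<close> lies within \<open>R + N s + C\<close>
    of \<open>t n\<close>; \<open>n >= m\<close> puts it inside the forbidden radius
    \<open>Suc n\<close>.\<close>
  obtain m :: nat where m: "R + N s + C < real m" using reals_Archimedean2 by blast
  have "finite (shift s x')" using \<open>finite x'\<close> by (simp add: shift_def)
  then obtain n where n: "n \<ge> m" "z n \<inter> shift s x' = Z \<inter> shift s x'" using Z by blast
  define q where "q = - (w n + t n) + s"
  have "shift s x' \<subseteq> shift (w n + t n) x" using n(2) sZ by (auto simp: z_def)
  then have "shift (- (w n + t n)) (shift s x') \<subseteq> x"
    unfolding shift_subset_iff[of "- (w n + t n)" "shift s x'"] minus_minus .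
  then have "shift q x' \<subseteq> x" by (simp only: q_def shift_shift)
  moreover have "\<Union> (shift q x') \<subseteq> nball N (t n) (real (Suc n))"
  proof
    fix p assume "p \<in> \<Union> (shift q x')"
    then have "p + q \<in> \<Union> x'" by (simp add: Union_shift del: Union_iff)
    then have "N (p + q) < R" by (rule R(2))
    then have "N ((p + q) + (w n - s)) < R + (C + N s)"
      using N_add[of "p + q" "w n - s"] N_diff[of "w n" s] w(1)[of n] by linarith
    moreover have "(p + q) + (w n - s) = p - t n" by (simp add: q_def)
    ultimately have "N (p - t n) < R + (C + N s)" by (simp only:)
    then show "p \<in> nball N (t n) (real (Suc n))" using m n(1) by (simp add: nball_def)
  qed
  ultimately show False using t by blast
qed

end

theorem theorem6p13:
  fixes N :: "real ^ 'd \<Rightarrow> real"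
    and \<T> :: "(real ^ 'd) set set set"
    and x :: "(real ^ 'd) set set"
  assumes "is_norm N"
    and "finite \<T>" and "\<T> \<subseteq> prototiles"
    and "x \<in> tiling_space \<T>"
  shows "(repetitive N \<T> x \<longrightarrow> minimal_set N \<T> (orbit_closure N \<T> x)) \<and>
    (finite_local_complexity \<T> x \<longrightarrow>
       minimal_set N \<T> (orbit_closure N \<T> x) \<longrightarrow> repetitive N \<T> x)"
proof -
  interpret finite_prototiles N \<T> using assms(1-3) by unfold_locales
  show ?thesis using repetitive_imp_minimal minimal_imp_repetitive assms(4) by blast
qed

end
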